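(* Let $\sigma\in\mathcal{S}_n$ be a permutation of $[n]=\{1,\dots,n\}$ with $c$ cycles (fixed points counted as cycles). Then $\sigma$ is an automorphism of exactly $|\mathcal{I}[c]|$ interval orders on $[n]$, where $|\mathcal{I}[c]|$ is the number of (labeled) interval orders on $[c]$.
   Context: A poset on a finite set $U$ is an irreflexive transitive relation on $U$. It is an interval order if it is $(2{+}2)$-free, i.e. has no induced subposet isomorphic to the disjoint union of two two-element chains. $\mathcal{I}[c]$ is the set of interval orders on $[c]=\{1,\dots,c\}$. A permutation $\sigma$ is an automorphism of a poset $P$ (viewed as a set of ordered pairs) if $\{(\sigma x,\sigma y):(x,y)\in P\}=P$. *)

theory Defs
  imports "HOL-Combinatorics.Combinatorics"
begin

definition poset_on :: "'a set \<Rightarrow> 'a rel \<Rightarrow> bool" where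
  "poset_on U P \<longleftrightarrow> P \<subseteq> U \<times> U \<and> irrefl P \<and> trans P"

(* The ground set is an explicit argument, as it cannot be recovered from the strict relation
   when there are isolated elements. *)
definition poset_isomorphic :: "'a set \<Rightarrow> 'a rel \<Rightarrow> 'b set \<Rightarrow> 'b rel \<Rightarrow> bool" where
  "poset_isomorphic U P V Q \<longleftrightarrow>
     (\<exists>f. bij_betw f U V \<and> (\<forall>x\<in>U. \<forall>y\<in>U. (x, y) \<in> P \<longleftrightarrow> (f x, f y) \<in> Q))"

(* The disjoint union of the chains 0 < 1 and 2 < 3, with ground set {0, 1, 2, 3}. *)
definition two_plus_two :: "nat rel" where
  "two_plus_two = {(0, 1), (2, 3)}"

definition two_plus_two_free :: "'a set \<Rightarrow> 'a rel \<Rightarrow> bool" where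
  "two_plus_two_free U P \<longleftrightarrow>
     \<not> (\<exists>W\<subseteq>U. poset_isomorphic W (Restr P W) {0, 1, 2, 3} two_plus_two)"

definition interval_order_on :: "'a set \<Rightarrow> 'a rel \<Rightarrow> bool" where
  "interval_order_on U P \<longleftrightarrow> poset_on U P \<and> two_plus_two_free U P"

definition interval_orders :: "nat \<Rightarrow> nat rel set" where
  "interval_orders c = {P. interval_order_on {1..c} P}"

definition automorphism :: "('a \<Rightarrow> 'a) \<Rightarrow> 'a rel \<Rightarrow> bool" where
  "automorphism \<sigma> P \<longleftrightarrow> {(\<sigma> x, \<sigma> y) | x y. (x, y) \<in> P} = P"

(* A cycle is identified with the set of points it moves through, so a fixed point x
   contributes the cycle {x}. *)
definition cycles_on :: "'a set \<Rightarrow> ('a \<Rightarrow> 'a) \<Rightarrow> 'a set set" where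
  "cycles_on U \<sigma> = orbit \<sigma> ` U"

end

theory Submission
  imports Defs
begin

text \<open>
  Being \<open>(2+2)\<close>-free means that the up-sets \<open>P `` {x}\<close>, and likewise the down-sets, form a
  chain under inclusion. An automorphism of a finite interval order \<open>P\<close> maps the up-set of \<open>x\<close>
  bijectively onto the up-set of \<open>\<sigma> x\<close>, and two comparable finite sets of the same size are equal.
  So \<open>x\<close> and \<open>\<sigma> x\<close> lie below exactly the same points (\<open>ferrers_automorphism_Image\<close>) and, by
  duality, above the same points. Hence whether \<open>x\<close> is below \<open>y\<close> depends only on the cycles of \<open>x\<close>
  and \<open>y\<close>, and \<open>P\<close> is the pullback of a relation on the set of cycles
  (\<open>automorphism_order_constant_on_orbits\<close>).

  Conversely, every relation on the cycles has a pullback that \<open>\<sigma>\<close> preserves, and pulling back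
  along a surjection both preserves and reflects interval orders
  (\<open>interval_order_on_pullback_iff\<close>). Numbering the cycles by \<open>{1..c}\<close>, pullback is therefore the
  required bijection.
\<close>

text \<open>
  The linear ordering of the up-sets, and of the down-sets, in a form without quantification over
  four-element subsets; relations with this property are known as Ferrers relations.
\<close>

definition ferrers :: "'a rel \<Rightarrow> bool" where
  "ferrers P \<longleftrightarrow> (\<forall>a b c d. (a, b) \<in> P \<longrightarrow> (c, d) \<in> P \<longrightarrow> (a, d) \<in> P \<or> (c, b) \<in> P)"

lemma ferrersD: "ferrers P \<Longrightarrow> (a, b) \<in> P \<Longrightarrow> (c, d) \<in> P \<Longrightarrow> (a, d) \<in> P \<or> (c, b) \<in> P"
  unfolding ferrers_def by blast

lemma ferrers_converse: "ferrers P \<Longrightarrow> ferrers (P\<inverse>)"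
  unfolding ferrers_def by blast

text \<open>
  A violation of the Ferrers condition consists of relations \<open>a < b\<close> and \<open>c < d\<close> with neither
  \<open>a < d\<close> nor \<open>c < b\<close>. By transitivity, any coincidence or further relation among the four points
  would force one of these two, so they form an induced \<open>2+2\<close>.
\<close>

lemma two_plus_two_free_iff_ferrers:
  assumes "poset_on U P"
  shows "two_plus_two_free U P \<longleftrightarrow> ferrers P"
proof
  assume free: "two_plus_two_free U P"
  have sub: "P \<subseteq> U \<times> U" and irr: "\<And>x. (x, x) \<notin> P"
    and tr: "\<And>x y z. (x, y) \<in> P \<Longrightarrow> (y, z) \<in> P \<Longrightarrow> (x, z) \<in> P"
    using assms unfolding poset_on_def irrefl_def trans_def by blast+
  show "ferrers P"
  proof (rule ccontr)
    assume "\<not> ferrers P"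
    then obtain a b c d where ab: "(a, b) \<in> P" and cd: "(c, d) \<in> P"
      and ad: "(a, d) \<notin> P" and cb: "(c, b) \<notin> P"
      unfolding ferrers_def by blast
    have dist: "a \<noteq> b" "a \<noteq> c" "a \<noteq> d" "b \<noteq> c" "b \<noteq> d" "c \<noteq> d"
      using ab cd ad cb irr tr by blast+
    have none: "(b, a) \<notin> P" "(a, c) \<notin> P" "(c, a) \<notin> P" "(d, a) \<notin> P" "(b, c) \<notin> P"
      "(b, d) \<notin> P" "(d, b) \<notin> P" "(d, c) \<notin> P"
      using ab cd ad cb irr tr by meson+
    let ?f = "\<lambda>x. if x = a then 0 else if x = b then 1 else if x = c then 2 else 3 :: nat"
    have "bij_betw ?f {a, b, c, d} {0, 1, 2, 3}"
      using dist unfolding bij_betw_def inj_on_def by auto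
    moreover have "\<forall>x\<in>{a, b, c, d}. \<forall>y\<in>{a, b, c, d}.
        (x, y) \<in> Restr P {a, b, c, d} \<longleftrightarrow> (?f x, ?f y) \<in> two_plus_two"
      using dist none ab cd ad cb irr by (auto simp: two_plus_two_def)
    ultimately have
      "poset_isomorphic {a, b, c, d} (Restr P {a, b, c, d}) {0, 1, 2, 3} two_plus_two"
      unfolding poset_isomorphic_def by blast
    moreover have "{a, b, c, d} \<subseteq> U"
      using ab cd sub by auto
    ultimately show False
      using free unfolding two_plus_two_free_def by blast
  qed
next
  assume ferr: "ferrers P"
  show "two_plus_two_free U P"
    unfolding two_plus_two_free_def
  proof
    assume "\<exists>W\<subseteq>U. poset_isomorphic W (Restr P W) {0, 1, 2, 3} two_plus_two"
    then obtain W f where bij: "bij_betw f W {0, 1, 2, 3}"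
      and iso: "\<And>x y. x \<in> W \<Longrightarrow> y \<in> W \<Longrightarrow> (x, y) \<in> P \<longleftrightarrow> (f x, f y) \<in> two_plus_two"
      unfolding poset_isomorphic_def by blast
    have "f ` W = {0, 1, 2, 3}"
      using bij by (simp add: bij_betw_def)
    then have "0 \<in> f ` W" "1 \<in> f ` W" "2 \<in> f ` W" "3 \<in> f ` W"
      by simp_all
    then obtain a b c d where W: "a \<in> W" "b \<in> W" "c \<in> W" "d \<in> W"
      and val: "f a = 0" "f b = 1" "f c = 2" "f d = 3"
      unfolding image_iff by metis
    have "(a, b) \<in> P" "(c, d) \<in> P" "(a, d) \<notin> P" "(c, b) \<notin> P"
      using iso W val by (simp_all add: two_plus_two_def)
    then show False
      using ferrersD[OF ferr] by blast
  qed
qed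

text \<open>
  Transitivity is absorbed: for \<open>a < b\<close> and \<open>b < d\<close> the Ferrers condition gives \<open>a < d\<close> or \<open>b < b\<close>.
\<close>

lemma interval_order_on_iff:
  "interval_order_on U P \<longleftrightarrow> P \<subseteq> U \<times> U \<and> irrefl P \<and> ferrers P"
proof
  assume "interval_order_on U P"
  then show "P \<subseteq> U \<times> U \<and> irrefl P \<and> ferrers P"
    using two_plus_two_free_iff_ferrers[of U P]
    unfolding interval_order_on_def poset_on_def by blast
next
  assume P: "P \<subseteq> U \<times> U \<and> irrefl P \<and> ferrers P"
  then have "trans P"
    unfolding trans_def irrefl_def ferrers_def by blast
  then have "poset_on U P"
    using P unfolding poset_on_def by blast
  then show "interval_order_on U P"
    using P two_plus_two_free_iff_ferrers unfolding interval_order_on_def by blast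
qed

lemma automorphism_converse: "automorphism \<sigma> P \<Longrightarrow> automorphism \<sigma> (P\<inverse>)"
  unfolding automorphism_def by blast

text \<open>
  The image of the up-set of \<open>x\<close> under \<open>\<sigma>\<close> is the up-set of \<open>\<sigma> x\<close>. The two up-sets are comparable
  and have the same size, so finiteness makes them equal.
\<close>

lemma ferrers_automorphism_Image:
  assumes fin: "finite P" and ferr: "ferrers P" and inj: "inj \<sigma>" and aut: "automorphism \<sigma> P"
  shows "P `` {\<sigma> x} = P `` {x}"
proof -
  have finite_up: "finite (P `` {z})" for z
    using fin by (simp add: finite_Image)
  have "P `` {\<sigma> x} = \<sigma> ` (P `` {x})"
  proof
    show "\<sigma> ` (P `` {x}) \<subseteq> P `` {\<sigma> x}"
      using aut unfolding automorphism_def by blast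
    show "P `` {\<sigma> x} \<subseteq> \<sigma> ` (P `` {x})"
    proof
      fix z assume "z \<in> P `` {\<sigma> x}"
      then have "(\<sigma> x, z) \<in> {(\<sigma> u, \<sigma> v) | u v. (u, v) \<in> P}"
        using aut unfolding automorphism_def by simp
      then show "z \<in> \<sigma> ` (P `` {x})"
        using inj by (auto dest: injD)
    qed
  qed
  then have "card (P `` {\<sigma> x}) = card (P `` {x})"
    using inj by (metis card_image inj_on_subset subset_UNIV)
  moreover have "P `` {\<sigma> x} \<subseteq> P `` {x} \<or> P `` {x} \<subseteq> P `` {\<sigma> x}"
    using ferrersD[OF ferr] by blast
  ultimately show ?thesis
    using finite_up by (metis card_subset_eq)
qed

lemma ferrers_automorphism_Image_orbit:
  assumes "finite P" "ferrers P" "inj \<sigma>" "automorphism \<sigma> P" and "y \<in> orbit \<sigma> x"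
  shows "P `` {y} = P `` {x}"
  using assms(5) by induction (simp_all add: ferrers_automorphism_Image assms(1-4))

text \<open>
  The previous lemma handles the first coordinate; applied to the converse relation, it handles
  the second.
\<close>

lemma automorphism_order_constant_on_orbits:
  assumes P: "finite P" "ferrers P" "inj \<sigma>" "automorphism \<sigma> P"
    and orb: "x' \<in> orbit \<sigma> x" "y' \<in> orbit \<sigma> y"
  shows "(x', y') \<in> P \<longleftrightarrow> (x, y) \<in> P"
proof -
  have "P `` {x'} = P `` {x}"
    using ferrers_automorphism_Image_orbit[OF P orb(1)] .
  moreover have "P\<inverse> `` {y'} = P\<inverse> `` {y}"
    using P orb(2)
    by (intro ferrers_automorphism_Image_orbit[of "P\<inverse>" \<sigma>])
      (simp_all add: ferrers_converse automorphism_converse)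
  ultimately show ?thesis
    by blast
qed

definition pullback :: "'a set \<Rightarrow> ('a \<Rightarrow> 'b) \<Rightarrow> 'b rel \<Rightarrow> 'a rel" where
  "pullback A f Q = Restr (inv_image Q f) A"

lemma mem_pullback: "(x, y) \<in> pullback A f Q \<longleftrightarrow> x \<in> A \<and> y \<in> A \<and> (f x, f y) \<in> Q"
  unfolding pullback_def by auto

text \<open>
  Unlike the definition by induced subposets, irreflexivity and the Ferrers condition are universal
  sentences without equality, so they can be checked on representatives of the fibres.
\<close>

lemma interval_order_on_pullback_iff:
  assumes surj: "f ` A = B" and sub: "Q \<subseteq> B \<times> B"
  shows "interval_order_on A (pullback A f Q) \<longleftrightarrow> interval_order_on B Q"
proof -
  have "irrefl (pullback A f Q) \<longleftrightarrow> (\<forall>x\<in>f ` A. (x, x) \<notin> Q)"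
    unfolding irrefl_def mem_pullback by blast
  then have "irrefl (pullback A f Q) \<longleftrightarrow> irrefl Q"
    using surj sub unfolding irrefl_def by blast
  moreover have "ferrers (pullback A f Q) \<longleftrightarrow> ferrers Q"
  proof
    assume ferr: "ferrers (pullback A f Q)"
    show "ferrers Q"
      unfolding ferrers_def
    proof (intro allI impI)
      fix a b c d assume ab: "(a, b) \<in> Q" and cd: "(c, d) \<in> Q"
      then have "a \<in> f ` A" "b \<in> f ` A" "c \<in> f ` A" "d \<in> f ` A"
        using surj sub by auto
      then obtain x y z w where A: "x \<in> A" "y \<in> A" "z \<in> A" "w \<in> A"
        and val: "a = f x" "b = f y" "c = f z" "d = f w"
        by (elim imageE)
      then show "(a, d) \<in> Q \<or> (c, b) \<in> Q"
        using ferrersD[OF ferr, of x y z w] ab cd by (simp add: mem_pullback)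
    qed
  next
    assume "ferrers Q"
    then show "ferrers (pullback A f Q)"
      using ferrersD[of Q "f _" "f _" "f _" "f _"] unfolding ferrers_def mem_pullback by simp
  qed
  moreover have "pullback A f Q \<subseteq> A \<times> A"
    unfolding pullback_def by blast
  ultimately show ?thesis
    using sub unfolding interval_order_on_iff by blast
qed

lemma inj_on_pullback:
  assumes "f ` A = B"
  shows "inj_on (pullback A f) {Q. Q \<subseteq> B \<times> B}"
proof (rule inj_onI)
  have sub: "Q \<subseteq> R" if Q: "Q \<subseteq> B \<times> B" and eq: "pullback A f Q = pullback A f R" for Q R
  proof
    fix p assume p: "p \<in> Q"
    obtain x y where xy: "p = (f x, f y)" "x \<in> A" "y \<in> A"
      using p Q assms by auto
    then have "(x, y) \<in> pullback A f R"
      using p eq by (metis mem_pullback)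
    then show "p \<in> R"
      using xy by (simp add: mem_pullback)
  qed
  fix Q R assume "Q \<in> {Q. Q \<subseteq> B \<times> B}" "R \<in> {Q. Q \<subseteq> B \<times> B}" "pullback A f Q = pullback A f R"
  then show "Q = R"
    using sub by (metis mem_Collect_eq subset_antisym)
qed

text \<open>
  A pullback along \<open>f\<close> only sees the values of \<open>f\<close>, and these do not change under \<open>\<sigma>\<close>.
\<close>

lemma automorphism_pullback:
  assumes perm: "\<sigma> permutes A" and inv: "\<And>x. x \<in> A \<Longrightarrow> f (\<sigma> x) = f x"
  shows "automorphism \<sigma> (pullback A f Q)"
  unfolding automorphism_def
proof
  show "{(\<sigma> x, \<sigma> y) | x y. (x, y) \<in> pullback A f Q} \<subseteq> pullback A f Q"
    using inv permutes_in_image[OF perm] by (auto simp: mem_pullback)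
  show "pullback A f Q \<subseteq> {(\<sigma> x, \<sigma> y) | x y. (x, y) \<in> pullback A f Q}"
  proof
    fix p assume p: "p \<in> pullback A f Q"
    obtain x y where xy: "p = (\<sigma> x, \<sigma> y)" "x \<in> A" "y \<in> A"
      using p permutes_image[OF perm] unfolding pullback_def by blast
    then have "(x, y) \<in> pullback A f Q"
      using p inv by (simp add: mem_pullback)
    then show "p \<in> {(\<sigma> x, \<sigma> y) | x y. (x, y) \<in> pullback A f Q}"
      using xy by blast
  qed
qed

text \<open>
  Here \<open>f\<close> is any labelling of the points by the elements of \<open>B\<close> whose fibres are the cycles.
  The inverse of pullback sends an invariant order to its image under \<open>f\<close>.
\<close>

lemma bij_betw_pullback_invariant_interval_orders:
  assumes fin: "finite A" and perm: "\<sigma> permutes A" and surj: "f ` A = B"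
    and fibres: "\<And>x y. x \<in> A \<Longrightarrow> y \<in> A \<Longrightarrow> f x = f y \<longleftrightarrow> orbit \<sigma> x = orbit \<sigma> y"
  shows "bij_betw (pullback A f) {Q. interval_order_on B Q}
           {P. interval_order_on A P \<and> automorphism \<sigma> P}"
proof -
  have "permutation \<sigma>"
    using perm fin by (auto simp: permutation_permutes)
  then have self: "x \<in> orbit \<sigma> x" and step: "orbit \<sigma> (\<sigma> x) = orbit \<sigma> x" for x
    by (simp_all add: permutation_self_in_orbit permutation_orbit_step)
  have inv: "f (\<sigma> x) = f x" if "x \<in> A" for x
    using fibres step that permutes_in_image[OF perm] by simp
  have "P \<in> pullback A f ` {Q. interval_order_on B Q}"
    if P: "interval_order_on A P" "automorphism \<sigma> P" for P
  proof -
    let ?Q = "map_prod f f ` P"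
    have sub: "P \<subseteq> A \<times> A" and ferr: "ferrers P"
      using P(1) unfolding interval_order_on_iff by blast+
    have finP: "finite P"
      using sub fin by (meson finite_SigmaI finite_subset)
    have "(x, y) \<in> P" if "x \<in> A" "y \<in> A" and im: "(f x, f y) \<in> ?Q" for x y
    proof -
      obtain x' y' where xy: "(x', y') \<in> P" "f x = f x'" "f y = f y'"
        using im by auto
      then have "orbit \<sigma> x = orbit \<sigma> x'" "orbit \<sigma> y = orbit \<sigma> y'"
        using fibres that(1,2) sub by blast+
      then have "x' \<in> orbit \<sigma> x" "y' \<in> orbit \<sigma> y"
        using self by auto
      then show ?thesis
        using automorphism_order_constant_on_orbits[OF finP ferr permutes_inj[OF perm] P(2)] xy(1)
        by blast
    qed
    then have eq: "pullback A f ?Q = P"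
      using sub by (force simp: mem_pullback)
    have "?Q \<subseteq> B \<times> B"
      using sub surj by auto
    then have "interval_order_on B ?Q"
      using interval_order_on_pullback_iff[OF surj] eq P(1) by metis
    then show ?thesis
      using eq by blast
  qed
  moreover have "interval_order_on A (pullback A f Q) \<and> automorphism \<sigma> (pullback A f Q)"
    if "interval_order_on B Q" for Q
    using that interval_order_on_pullback_iff[OF surj] automorphism_pullback[OF perm] inv
    unfolding interval_order_on_iff by blast
  moreover have "inj_on (pullback A f) {Q. interval_order_on B Q}"
    using inj_on_pullback[OF surj] by (rule inj_on_subset) (auto simp: interval_order_on_iff)
  ultimately show ?thesis
    unfolding bij_betw_def by blast
qed

theorem corollary7p2:
  fixes \<sigma> :: "nat \<Rightarrow> nat" and n c :: nat
  assumes "\<sigma> permutes {1..n}"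
    and "card (cycles_on {1..n} \<sigma>) = c"
  shows "card {P \<in> interval_orders n. automorphism \<sigma> P} = card (interval_orders c)"
proof -
  have "finite (cycles_on {1..n} \<sigma>)"
    by (simp add: cycles_on_def)
  then obtain h where h: "bij_betw h (cycles_on {1..n} \<sigma>) {1..c}"
    using assms(2) by (metis card_atLeastAtMost diff_Suc_1 finite_atLeastAtMost
        finite_same_card_bij)
  let ?f = "\<lambda>x. h (orbit \<sigma> x)"
  have surj: "?f ` {1..n} = {1..c}"
    using h unfolding bij_betw_def cycles_on_def by (simp add: image_image)
  have "?f x = ?f y \<longleftrightarrow> orbit \<sigma> x = orbit \<sigma> y" if "x \<in> {1..n}" "y \<in> {1..n}" for x y
    using h that unfolding bij_betw_def cycles_on_def by (metis imageI inj_on_eq_iff)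
  from bij_betw_pullback_invariant_interval_orders[OF finite_atLeastAtMost assms(1) surj this]
  have "card {Q. interval_order_on {1..c} Q}
      = card {P. interval_order_on {1..n} P \<and> automorphism \<sigma> P}"
    by (rule bij_betw_same_card)
  then show ?thesis
    unfolding interval_orders_def by simp
qed

end
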